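(* Let $\mathbb F$ be a field, $d\ge1$ an integer, $A=A(d,\mathbb F)$. Let $n,m\ge1$ and let $(r_1,\ldots,r_n)$ and $(r'_1,\ldots,r'_m)$ be NR words in $A$ that end with a nonstarred element. Then the product $$Q=(r_1,r_2,\ldots,r_n)^*\cdot(r'_1,r'_2,\ldots,r'_m)$$ is the following linear combination of NR words in $A$ that end with a nonstarred element. (i) If $m$ is even and $r_n\ne r'_1$, then $Q=0$. (ii) If $m$ is even and $r_n=r'_1$, then $Q=(r_1,r_2,\ldots,r_n,r'_2,\ldots,r'_m)$. (iii) If $m$ is odd and $r_n\neq r'_1$, then $Q=(r_1,r_2,\ldots,r_n,r'_1,r'_2,\ldots,r'_m)$. (iv) If $m$ is odd and $r_n=r'_1$, then $$Q=(-1)^{n+1}(r_1,\ldots,r_n,r'_2,\ldots,r'_m)+(-1)^n\sum_{\substack{0\le j\le d\\ j\ne r_1}}(j,r_1,\ldots,r_n,r'_2,\ldots,r'_m)+\sum_{\ell=1}^{n-1}(-1)^{n-\ell}\sum_{\substack{0\le j\le d\\ j\ne r_\ell,\ j\ne r_{\ell+1}}}(r_1,\ldots,r_\ell,j,r_{\ell+1},\ldots,r_n,r'_2,\ldots,r'_m).$$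
   Context: Algebras are associative and have a $1$. For a field $\mathbb F$ and an integer $d\ge 1$, $A=A(d,\mathbb F)$ is the $\mathbb F$-algebra defined by generators $\{e_i\}_{i=0}^d$, $\{e^*_i\}_{i=0}^d$ and relations $e_ie_j=\delta_{i,j}e_i$, $e^*_ie^*_j=\delta_{i,j}e^*_i$ $(0\le i,j\le d)$, $1=\sum_{i=0}^d e_i$, $1=\sum_{i=0}^d e^*_i$. The $e_i,e_i^*$ are the idempotent generators; the $e^*_i$ are called starred and the $e_i$ nonstarred; $i$ is the index of $e_i$ and of $e^*_i$. There is a unique $\mathbb F$-algebra automorphism $*$ of $A$, written $x\mapsto x^*$, that swaps $e_i$ and $e^*_i$ for $0\le i\le d$. For $n\ge1$, a word of length $n$ in $A$ is a product $g_1g_2\cdots g_n$ of idempotent generators such that for $2\le j\le n$ exactly one of $g_{j-1},g_j$ is starred. It begins with $g_1$ and ends with $g_n$. The word is nonrepeating (NR) if $g_{j-1},g_j$ have different indices for $2\le j\le n$. Notation: for $r_1,\dots,r_n\in\{0,\dots,d\}$, $(r_1,\ldots,r_n)$ denotes the word $g_1\cdots g_n$ of length $n$ such that $g_n$ is nonstarred and $g_j$ has index $r_j$ for $1\le j\le n$ (so $g_n=e_{r_n}$, $g_{n-1}=e^*_{r_{n-1}}$, $g_{n-2}=e_{r_{n-2}}$, and so on, alternating). $(r_1,\ldots,r_n)^*$ denotes the image of this word under $*$, i.e. the word with the same indices ending in the starred element $e^*_{r_n}$. The NR words ending with a nonstarred element form a basis of the $\mathbb F$-vector space $A$. *)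

theory Defs
  imports "HOL-Algebra.QuotRing" "HOL-Algebra.Module" "HOL-Library.Poly_Mapping"
begin

datatype 'g free_monoid = Word (letters: "'g list")

instantiation free_monoid :: (type) monoid_add
begin

definition zero_free_monoid :: "'a free_monoid" where
  "0 = Word []"

definition plus_free_monoid :: "'a free_monoid \<Rightarrow> 'a free_monoid \<Rightarrow> 'a free_monoid" where
  "u + v = Word (letters u @ letters v)"

instance
  by standard (simp_all add: zero_free_monoid_def plus_free_monoid_def)

end

text \<open>
  With this (concatenation) monoid as keys, \<open>'g free_monoid \<Rightarrow>\<^sub>0 'f\<close> with the library's
  multiplication of polynomial mappings (convolution) is the free associative unital
  algebra over \<open>'f\<close> on all of \<open>'g\<close>; restricting the carrier gives the free
  algebra on a set \<open>G\<close> of generators.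
\<close>

type_synonym ('g, 'f) ncpoly = "'g free_monoid \<Rightarrow>\<^sub>0 'f"

definition free_algebra :: "'g set \<Rightarrow> ('f::field, ('g, 'f) ncpoly) module" where
  "free_algebra G =
     \<lparr>carrier = {p. \<forall>w\<in>Poly_Mapping.keys p. set (letters w) \<subseteq> G},
      mult = (*), one = 1, zero = 0, add = (+),
      smult = (\<lambda>c p. Poly_Mapping.single 0 c * p)\<rparr>"

definition var :: "'g \<Rightarrow> ('g, 'f::field) ncpoly" where
  "var g = Poly_Mapping.single (Word [g]) 1"

text \<open>
  The library quotient ring \<open>R Quot I\<close>, extended by the scalar multiplication it lacks; the
  latter is formed in the same way as the library's product of cosets.
\<close>

definition quot_algebra ::
    "('f, 'a) module \<Rightarrow> 'a set \<Rightarrow> ('f, 'a set) module" where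
  "quot_algebra R I =
     \<lparr>carrier = carrier (R Quot I), mult = mult (R Quot I), one = one (R Quot I),
      zero = zero (R Quot I), add = add (R Quot I),
      smult = (\<lambda>c X. \<Union>x\<in>X. I +>\<^bsub>R\<^esub> (c \<odot>\<^bsub>R\<^esub> x))\<rparr>"

text \<open>\<open>E i\<close> stands for $e_i$ and \<open>Es i\<close> for the starred generator $e^*_i$.\<close>

datatype gen = E nat | Es nat

definition gens :: "nat \<Rightarrow> gen set" where
  "gens d = E ` {0..d} \<union> Es ` {0..d}"

text \<open>A relation \<open>l = r\<close> is represented by the element \<open>l - r\<close> of the free algebra.\<close>

definition relators :: "nat \<Rightarrow> (gen, 'f::field) ncpoly set" where
  "relators d =
     {var (E i) * var (E j) - (if i = j then var (E i) else 0) |i j. i \<le> d \<and> j \<le> d} \<union>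
     {var (Es i) * var (Es j) - (if i = j then var (Es i) else 0) |i j. i \<le> d \<and> j \<le> d} \<union>
     {1 - (\<Sum>i=0..d. var (E i)), 1 - (\<Sum>i=0..d. var (Es i))}"

definition rel_ideal :: "nat \<Rightarrow> (gen, 'f::field) ncpoly set" where
  "rel_ideal d = genideal (free_algebra (gens d)) (relators d)"

definition alg :: "nat \<Rightarrow> ('f::field, (gen, 'f) ncpoly set) module" where
  "alg d = quot_algebra (free_algebra (gens d)) (rel_ideal d)"

definition proj :: "nat \<Rightarrow> (gen, 'f::field) ncpoly \<Rightarrow> (gen, 'f) ncpoly set" where
  "proj d p = rel_ideal d +>\<^bsub>free_algebra (gens d)\<^esub> p"

definition gen_elt :: "nat \<Rightarrow> gen \<Rightarrow> (gen, 'f::field) ncpoly set" where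
  "gen_elt d g = proj d (var g)"

fun swap_gen :: "gen \<Rightarrow> gen" where
  "swap_gen (E i) = Es i"
| "swap_gen (Es i) = E i"

text \<open>
  \<open>map_key f p\<close> is \<open>p \<circ> f\<close>, i.e. substitution along the inverse of \<open>f\<close>; here \<open>f\<close> is an
  involution.
\<close>

definition swap_poly :: "(gen, 'f::field) ncpoly \<Rightarrow> (gen, 'f) ncpoly" where
  "swap_poly = Poly_Mapping.map_key (map_free_monoid swap_gen)"

text \<open>
  On the quotient, \<open>*\<close> sends a coset to its image under the swap. That this is the
  automorphism exchanging \<open>E i\<close> and \<open>Es i\<close> is shown in \<open>star_automorphism\<close> below.
\<close>

definition star :: "(gen, 'f::field) ncpoly set \<Rightarrow> (gen, 'f) ncpoly set" where
  "star X = swap_poly ` X"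

text \<open>
  The alternating sequence of generators with the given indices whose last letter is
  nonstarred: a letter is nonstarred iff the number of letters after it is even.
\<close>

fun alt_gens :: "nat list \<Rightarrow> gen list" where
  "alt_gens [] = []"
| "alt_gens (r # rs) = (if even (length rs) then E r else Es r) # alt_gens rs"

definition word :: "nat \<Rightarrow> nat list \<Rightarrow> (gen, 'f::field) ncpoly set" where
  "word d rs = foldr (mult (alg d)) (map (gen_elt d) (alt_gens rs)) \<one>\<^bsub>alg d\<^esub>"

text \<open>
  A word ending with a nonstarred letter is given by its list of indices, so nonrepeating
  is a condition on that list; the nonrepeating words of length \<open>n\<close> ending with a starred
  letter are the elements \<open>star (word d rs)\<close>. Lists are 0-based: the index $r_l$ of
  $(r_1,...,r_n)$ is \<open>rs ! (l - 1)\<close>.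
\<close>

definition NR :: "nat \<Rightarrow> nat list \<Rightarrow> bool" where
  "NR d rs \<longleftrightarrow> rs \<noteq> [] \<and> set rs \<subseteq> {0..d} \<and> distinct_adj rs"

lemma poly_mapping_sum_induct [case_names zero single_add]:
  assumes "P 0"
    and "\<And>k v p. P p \<Longrightarrow> P (Poly_Mapping.single k v + p)"
  shows "P (p :: 'a \<Rightarrow>\<^sub>0 'b::comm_monoid_add)"
proof (induction p rule: update_induct)
  case const
  then show ?case using assms(1) unfolding zero_poly_mapping_def .
next
  case (update p k v)
  have "Poly_Mapping.lookup p k = 0"
    using update(1) by (simp add: in_keys_iff)
  then have "Poly_Mapping.update k v p = Poly_Mapping.single k v + p"
    by (intro poly_mapping_eqI)
      (auto simp add: lookup_update lookup_add lookup_single when_def in_keys_iff)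
  then show ?case using assms(2)[OF update(3)] by simp
qed

lemma free_carrier_iff: "p \<in> carrier (free_algebra G) \<longleftrightarrow>
    (\<forall>w\<in>Poly_Mapping.keys p. set (letters w) \<subseteq> G)"
  by (simp add: free_algebra_def)

lemma free_add: "p \<in> carrier (free_algebra G) \<Longrightarrow> q \<in> carrier (free_algebra G) \<Longrightarrow>
    p + q \<in> carrier (free_algebra G)"
  using Poly_Mapping.keys_add[of p q] unfolding free_carrier_iff by blast

lemma free_uminus: "p \<in> carrier (free_algebra G) \<Longrightarrow> - p \<in> carrier (free_algebra G)"
  unfolding free_carrier_iff by (simp add: in_keys_iff)

lemma free_minus: "p \<in> carrier (free_algebra G) \<Longrightarrow> q \<in> carrier (free_algebra G) \<Longrightarrow>
    p - q \<in> carrier (free_algebra G)"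
  using free_add[of p G "- q"] free_uminus[of q G] by simp

lemma free_mult:
  assumes "p \<in> carrier (free_algebra G)" "q \<in> carrier (free_algebra G)"
  shows "p * q \<in> carrier (free_algebra G)"
  unfolding free_carrier_iff
proof
  fix w assume "w \<in> Poly_Mapping.keys (p * q)"
  then obtain a b where w: "w = a + b" "a \<in> Poly_Mapping.keys p" "b \<in> Poly_Mapping.keys q"
    using keys_mult[of p q] by blast
  then have "set (letters a) \<subseteq> G" "set (letters b) \<subseteq> G"
    using assms unfolding free_carrier_iff by auto
  then show "set (letters w) \<subseteq> G"
    using w(1) by (simp add: plus_free_monoid_def)
qed

lemma free_const: "Poly_Mapping.single 0 c \<in> carrier (free_algebra G)"
  by (simp add: free_carrier_iff zero_free_monoid_def)

lemma free_zero: "0 \<in> carrier (free_algebra G)"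
  by (simp add: free_carrier_iff)

lemma free_one: "1 \<in> carrier (free_algebra G)"
  using free_const[of 1 G] by simp

lemma free_sum: "(\<And>i. i \<in> S \<Longrightarrow> f i \<in> carrier (free_algebra G)) \<Longrightarrow>
    sum f S \<in> carrier (free_algebra G)"
  by (induction S rule: infinite_finite_induct) (auto simp: free_zero free_add)

lemma var_closed: "g \<in> G \<Longrightarrow> var g \<in> carrier (free_algebra G)"
  by (simp add: free_carrier_iff var_def)

lemma free_simps [simp]:
  "mult (free_algebra G) = (*)" "one (free_algebra G) = 1"
  "zero (free_algebra G) = 0" "add (free_algebra G) = (+)"
  "smult (free_algebra G) c p = Poly_Mapping.single 0 c * p"
  by (simp_all add: free_algebra_def)

lemma free_ring: "ring (free_algebra G)"
proof (rule ringI)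
  show "abelian_group (free_algebra G)"
  proof (rule abelian_groupI)
    fix x assume "x \<in> carrier (free_algebra G)"
    then show "\<exists>y\<in>carrier (free_algebra G). y \<oplus>\<^bsub>free_algebra G\<^esub> x = \<zero>\<^bsub>free_algebra G\<^esub>"
      by (intro bexI[of _ "- x"]) (simp_all add: free_uminus)
  qed (simp_all add: free_add free_zero add.assoc add.commute)
  show "Group.monoid (free_algebra G)"
    by (rule monoidI) (simp_all add: free_mult free_one mult.assoc)
qed (simp_all add: algebra_simps)

lemma const_commute:
  fixes p :: "('g, 'f::field) ncpoly"
  shows "Poly_Mapping.single 0 c * p = p * Poly_Mapping.single 0 c"
proof (induction p rule: poly_mapping_sum_induct)
  case (single_add k v p)
  then show ?case by (simp add: algebra_simps mult_single)
qed simp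

lemma relators_closed: "relators d \<subseteq> carrier (free_algebra (gens d))"
  unfolding relators_def gens_def
  by (auto intro!: free_minus free_mult free_zero free_one free_sum var_closed)

lemma rel_ideal: "ideal (rel_ideal d) (free_algebra (gens d))"
  unfolding rel_ideal_def by (rule ring.genideal_ideal[OF free_ring relators_closed])

lemma relators_in_ideal: "relators d \<subseteq> rel_ideal d"
  unfolding rel_ideal_def by (rule ring.genideal_self[OF free_ring relators_closed])

lemma ring_transfer:
  assumes "ring R" "carrier S = carrier R" "mult S = mult R" "one S = one R"
    "zero S = zero R" "add S = add R"
  shows "ring S"
proof -
  interpret R: ring R by fact
  show ?thesis
  proof (rule ringI)
    show "abelian_group S"
    proof (rule abelian_groupI)
      fix x assume "x \<in> carrier S"
      then show "\<exists>y\<in>carrier S. y \<oplus>\<^bsub>S\<^esub> x = \<zero>\<^bsub>S\<^esub>"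
        using assms by (intro bexI[of _ "\<ominus>\<^bsub>R\<^esub> x"]) (simp_all add: R.l_neg)
    qed (auto simp: assms R.a_assoc intro: R.a_comm)
    show "Group.monoid S"
      by (rule monoidI) (simp_all add: assms R.m_assoc)
  qed (simp_all add: assms R.l_distr R.r_distr)
qed

lemma alg_simps:
  "carrier (alg d) = carrier (free_algebra (gens d) Quot rel_ideal d)"
  "mult (alg d) = mult (free_algebra (gens d) Quot rel_ideal d)"
  "one (alg d) = one (free_algebra (gens d) Quot rel_ideal d)"
  "zero (alg d) = zero (free_algebra (gens d) Quot rel_ideal d)"
  "add (alg d) = add (free_algebra (gens d) Quot rel_ideal d)"
  by (simp_all add: alg_def quot_algebra_def)

lemma alg_ring: "ring (alg d)"
  by (rule ring_transfer[OF ideal.quotient_is_ring[OF rel_ideal[of d]]])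
    (simp_all add: alg_simps)

lemma proj_hom: "proj d \<in> ring_hom (free_algebra (gens d)) (alg d)"
  using ideal.rcos_ring_hom[OF rel_ideal[of d]]
  unfolding ring_hom_def proj_def by (simp add: alg_simps)

lemma proj_simps:
  assumes "p \<in> carrier (free_algebra (gens d))" "q \<in> carrier (free_algebra (gens d))"
  shows "proj d p \<in> carrier (alg d)"
    "proj d (p + q) = proj d p \<oplus>\<^bsub>alg d\<^esub> proj d q"
    "proj d (p * q) = proj d p \<otimes>\<^bsub>alg d\<^esub> proj d q"
  using ring_hom_memE[OF proj_hom[of d]] assms by simp_all

lemma proj_one: "proj d 1 = \<one>\<^bsub>alg d\<^esub>"
  using ring_hom_memE(4)[OF proj_hom[of d]] by simp

lemma proj_zero: "proj d 0 = \<zero>\<^bsub>alg d\<^esub>"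
  using ring_hom_zero[OF proj_hom free_ring alg_ring] by simp

lemma carrier_alg: "carrier (alg d) = proj d ` carrier (free_algebra (gens d))"
  unfolding alg_simps proj_def FactRing_def A_RCOSETS_defs a_r_coset_def by auto

lemma mem_proj: "x \<in> proj d p \<longleftrightarrow> x - p \<in> rel_ideal d"
  unfolding proj_def a_r_coset_def r_coset_def by (force simp: algebra_simps)

lemma rel_ideal_closed:
  assumes "x \<in> rel_ideal d"
  shows "y \<in> rel_ideal d \<Longrightarrow> x + y \<in> rel_ideal d"
    and "- x \<in> rel_ideal d"
    and "y \<in> carrier (free_algebra (gens d)) \<Longrightarrow> x * y \<in> rel_ideal d"
    and "y \<in> carrier (free_algebra (gens d)) \<Longrightarrow> y * x \<in> rel_ideal d"
proof -
  interpret ideal "rel_ideal d" "free_algebra (gens d)" by (rule rel_ideal)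
  show "y \<in> rel_ideal d \<Longrightarrow> x + y \<in> rel_ideal d" using additive_subgroup.a_closed[OF ideal.axioms(1)[OF rel_ideal], of x d y] assms by simp
  show "y \<in> carrier (free_algebra (gens d)) \<Longrightarrow> x * y \<in> rel_ideal d"
    using I_r_closed[of x y] assms by simp
  show l: "y \<in> carrier (free_algebra (gens d)) \<Longrightarrow> y * x \<in> rel_ideal d" for y
    using I_l_closed[of x y] assms by simp
  show "- x \<in> rel_ideal d" using l[OF free_uminus[OF free_one]] by simp
qed

lemma proj_eq_iff: "proj d p = proj d q \<longleftrightarrow> p - q \<in> rel_ideal d"
proof
  have "(0 :: (gen, 'a) ncpoly) \<in> rel_ideal d"
    using additive_subgroup.zero_closed[OF ideal.axioms(1)[OF rel_ideal[of d]]] by simp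
  then have "p \<in> proj d p" by (simp add: mem_proj)
  moreover assume "proj d p = proj d q"
  ultimately show "p - q \<in> rel_ideal d" by (simp add: mem_proj)
next
  assume *: "p - q \<in> rel_ideal d"
  have "x - p \<in> rel_ideal d \<longleftrightarrow> x - q \<in> rel_ideal d" for x
  proof
    assume "x - p \<in> rel_ideal d"
    from rel_ideal_closed(1)[OF this *] show "x - q \<in> rel_ideal d" by simp
  next
    assume "x - q \<in> rel_ideal d"
    from rel_ideal_closed(1)[OF this rel_ideal_closed(2)[OF *]] show "x - p \<in> rel_ideal d"
      by simp
  qed
  then show "proj d p = proj d q" by (auto simp: mem_proj)
qed

lemma alg_smult:
  assumes "p \<in> carrier (free_algebra (gens d))"
  shows "c \<odot>\<^bsub>alg d\<^esub> proj d p = proj d (Poly_Mapping.single 0 c * p)"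
proof -
  have "proj d (Poly_Mapping.single 0 c * x) = proj d (Poly_Mapping.single 0 c * p)"
    if "x \<in> proj d p" for x
    using rel_ideal_closed(4)[of "x - p" d "Poly_Mapping.single 0 c"] that
    by (simp add: proj_eq_iff mem_proj free_const right_diff_distrib)
  moreover have "p \<in> proj d p"
    using proj_eq_iff[of d p p] mem_proj[of p d p] by simp
  ultimately have "(\<Union>x\<in>proj d p. proj d (Poly_Mapping.single 0 c * x)) =
      proj d (Poly_Mapping.single 0 c * p)"
    by blast
  then show ?thesis
    by (simp add: alg_def quot_algebra_def proj_def)
qed

lemma gen_elt_closed: "g \<in> gens d \<Longrightarrow> gen_elt d g \<in> carrier (alg d)"
  unfolding gen_elt_def by (rule proj_simps[OF var_closed var_closed])

lemma gen_elt_mult: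
  assumes "i \<le> d" "j \<le> d"
  shows "gen_elt d (E i) \<otimes>\<^bsub>alg d\<^esub> gen_elt d (E j) =
      (if i = j then gen_elt d (E i) else (\<zero>\<^bsub>alg d\<^esub> :: (gen, 'f::field) ncpoly set))"
    and "gen_elt d (Es i) \<otimes>\<^bsub>alg d\<^esub> gen_elt d (Es j) =
      (if i = j then gen_elt d (Es i) else (\<zero>\<^bsub>alg d\<^esub> :: (gen, 'f::field) ncpoly set))"
proof -
  have "proj d (var (E i) * var (E j)) =
      proj d (if i = j then var (E i) else (0 :: (gen, 'f) ncpoly))"
    "proj d (var (Es i) * var (Es j)) =
      proj d (if i = j then var (Es i) else (0 :: (gen, 'f) ncpoly))"
    unfolding proj_eq_iff using assms
    by (intro subsetD[OF relators_in_ideal], unfold relators_def, blast)+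
  moreover have "E i \<in> gens d" "E j \<in> gens d" "Es i \<in> gens d" "Es j \<in> gens d"
    using assms by (auto simp: gens_def)
  ultimately show "gen_elt d (E i) \<otimes>\<^bsub>alg d\<^esub> gen_elt d (E j) =
      (if i = j then gen_elt d (E i) else (\<zero>\<^bsub>alg d\<^esub> :: (gen, 'f) ncpoly set))"
    "gen_elt d (Es i) \<otimes>\<^bsub>alg d\<^esub> gen_elt d (Es j) =
      (if i = j then gen_elt d (Es i) else (\<zero>\<^bsub>alg d\<^esub> :: (gen, 'f) ncpoly set))"
    unfolding gen_elt_def by (auto simp: proj_zero var_closed simp flip: proj_simps(3))
qed

lemma gen_elt_sum:
  "(\<Oplus>\<^bsub>alg d\<^esub>i\<in>{0..d}. gen_elt d (E i)) = (\<one>\<^bsub>alg d\<^esub> :: (gen, 'f::field) ncpoly set)"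
  "(\<Oplus>\<^bsub>alg d\<^esub>i\<in>{0..d}. gen_elt d (Es i)) = (\<one>\<^bsub>alg d\<^esub> :: (gen, 'f::field) ncpoly set)"
proof -
  interpret A: ring "alg d :: ('f, (gen, 'f) ncpoly set) module" by (rule alg_ring)
  have sum: "(\<Oplus>\<^bsub>alg d\<^esub>i\<in>{0..d}. gen_elt d (c i)) = (\<one>\<^bsub>alg d\<^esub> :: (gen, 'f) ncpoly set)"
    if c: "\<And>i. i \<le> d \<Longrightarrow> c i \<in> gens d"
      and r: "1 - (\<Sum>i=0..d. var (c i) :: (gen, 'f) ncpoly) \<in> relators d" for c
  proof -
    have *: "(\<Oplus>\<^bsub>alg d\<^esub>i\<in>S. gen_elt d (c i)) = proj d (\<Sum>i\<in>S. var (c i) :: (gen, 'f) ncpoly)"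
      if "finite S" "S \<subseteq> {0..d}" for S
      using that
    proof (induction S rule: finite_induct)
      case (insert x S)
      have "(var (c x) :: (gen, 'f) ncpoly) \<in> carrier (free_algebra (gens d))"
        "(\<Sum>i\<in>S. var (c i) :: (gen, 'f) ncpoly) \<in> carrier (free_algebra (gens d))"
        using insert.prems by (auto intro!: var_closed free_sum c)
      moreover have "(\<lambda>i. gen_elt d (c i) :: (gen, 'f) ncpoly set) \<in> S \<rightarrow> carrier (alg d)"
        "(gen_elt d (c x) :: (gen, 'f) ncpoly set) \<in> carrier (alg d)"
        using insert.prems by (auto intro!: gen_elt_closed c)
      ultimately show ?case
        using insert by (simp add: proj_simps gen_elt_def)
    qed (simp add: proj_zero)
    have "proj d 1 = proj d (\<Sum>i=0..d. var (c i) :: (gen, 'f) ncpoly)"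
      unfolding proj_eq_iff using r relators_in_ideal by blast
    then show ?thesis
      using *[of "{0..d}"] by (simp add: proj_one)
  qed
  show "(\<Oplus>\<^bsub>alg d\<^esub>i\<in>{0..d}. gen_elt d (E i)) = (\<one>\<^bsub>alg d\<^esub> :: (gen, 'f) ncpoly set)"
    "(\<Oplus>\<^bsub>alg d\<^esub>i\<in>{0..d}. gen_elt d (Es i)) = (\<one>\<^bsub>alg d\<^esub> :: (gen, 'f) ncpoly set)"
    by (rule sum; (simp add: gens_def)?; unfold relators_def; blast)+
qed

lemma swap_gen_swap [simp]: "swap_gen (swap_gen g) = g"
  by (cases g) auto

lemma swap_word_swap [simp]: "map_free_monoid swap_gen (map_free_monoid swap_gen w) = w"
  by (cases w) (simp add: comp_def)

lemma inj_swap_word: "inj (map_free_monoid swap_gen)"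
  by (metis injI swap_word_swap)

lemma swap_poly_single [simp]:
  "swap_poly (Poly_Mapping.single w c) = Poly_Mapping.single (map_free_monoid swap_gen w) c"
  using map_key_single[OF inj_swap_word, of "map_free_monoid swap_gen w" c]
  by (simp add: swap_poly_def)

lemma swap_poly_zero [simp]: "swap_poly 0 = 0"
  by (simp add: swap_poly_def map_key_zero[OF inj_swap_word])

lemma swap_poly_add [simp]: "swap_poly (p + q) = swap_poly p + swap_poly q"
  by (simp add: swap_poly_def map_key_plus[OF inj_swap_word])

lemma swap_poly_diff [simp]: "swap_poly (p - q) = swap_poly p - swap_poly q"
  using swap_poly_add[of "p - q" q] by (simp add: algebra_simps)

lemma swap_poly_sum [simp]: "swap_poly (sum f S) = (\<Sum>i\<in>S. swap_poly (f i))"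
  by (induction S rule: infinite_finite_induct) auto

lemma swap_poly_swap [simp]: "swap_poly (swap_poly p) = p"
  by (induction p rule: poly_mapping_sum_induct) auto

lemma swap_word_add:
  "map_free_monoid swap_gen (u + v) = map_free_monoid swap_gen u + map_free_monoid swap_gen v"
  by (cases u; cases v) (simp add: plus_free_monoid_def)

lemma swap_word_zero [simp]: "map_free_monoid swap_gen 0 = 0"
  by (simp add: zero_free_monoid_def)

lemma swap_poly_mult [simp]: "swap_poly (p * q) = swap_poly p * swap_poly q"
proof (induction p rule: poly_mapping_sum_induct)
  case (single_add k v p)
  have "swap_poly (Poly_Mapping.single k v * q) = swap_poly (Poly_Mapping.single k v) * swap_poly q"
    by (induction q rule: poly_mapping_sum_induct)
      (simp_all add: distrib_left mult_single swap_word_add)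
  then show ?case using single_add by (simp add: distrib_right)
qed simp

lemma swap_poly_const [simp]: "swap_poly (Poly_Mapping.single 0 c) = Poly_Mapping.single 0 c"
  by simp

lemma swap_poly_one [simp]: "swap_poly 1 = 1"
  using swap_poly_const[of 1] by simp

lemma swap_poly_var [simp]: "swap_poly (var g) = var (swap_gen g)"
  by (simp add: var_def)

lemma swap_gens: "swap_gen g \<in> gens d \<longleftrightarrow> g \<in> gens d"
  by (cases g) (auto simp: gens_def)

lemma swap_poly_closed:
  assumes "p \<in> carrier (free_algebra (gens d))"
  shows "swap_poly p \<in> carrier (free_algebra (gens d))"
  unfolding free_carrier_iff
proof
  fix w assume "w \<in> Poly_Mapping.keys (swap_poly p)"
  then have "map_free_monoid swap_gen w \<in> Poly_Mapping.keys p"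
    by (simp add: swap_poly_def keys_map_key[OF inj_swap_word])
  then have "set (letters (map_free_monoid swap_gen w)) \<subseteq> gens d"
    using assms by (simp add: free_carrier_iff)
  then show "set (letters w) \<subseteq> gens d"
    by (cases w) (auto simp: swap_gens)
qed

lemma swap_poly_hom: "swap_poly \<in> ring_hom (free_algebra (gens d)) (free_algebra (gens d))"
  by (rule ring_hom_memI) (simp_all add: swap_poly_closed)

lemma swap_relators: "p \<in> relators d \<Longrightarrow> swap_poly p \<in> relators d"
proof -
  assume "p \<in> relators d"
  then consider
      i j where "i \<le> d" "j \<le> d" "p = var (E i) * var (E j) - (if i = j then var (E i) else 0)"
    | i j where "i \<le> d" "j \<le> d" "p = var (Es i) * var (Es j) - (if i = j then var (Es i) else 0)"
    | "p = 1 - (\<Sum>i=0..d. var (E i))"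
    | "p = 1 - (\<Sum>i=0..d. var (Es i))"
    unfolding relators_def by blast
  then show ?thesis
  proof cases
    case (1 i j)
    then have "swap_poly p = var (Es i) * var (Es j) - (if i = j then var (Es i) else 0)"
      by simp
    then show ?thesis using 1(1,2) unfolding relators_def by blast
  next
    case (2 i j)
    then have "swap_poly p = var (E i) * var (E j) - (if i = j then var (E i) else 0)"
      by simp
    then show ?thesis using 2(1,2) unfolding relators_def by blast
  next
    case 3
    then have "swap_poly p = 1 - (\<Sum>i=0..d. var (Es i))" by simp
    then show ?thesis unfolding relators_def by blast
  next
    case 4
    then have "swap_poly p = 1 - (\<Sum>i=0..d. var (E i))" by simp
    then show ?thesis unfolding relators_def by blast
  qed
qed

lemma swap_rel_ideal: "p \<in> rel_ideal d \<Longrightarrow> swap_poly p \<in> rel_ideal d"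
proof -
  interpret ring_hom_ring "free_algebra (gens d)" "free_algebra (gens d)" swap_poly
    by (rule ring_hom_ringI2[OF free_ring free_ring swap_poly_hom])
  have "rel_ideal d \<subseteq> {r \<in> carrier (free_algebra (gens d)). swap_poly r \<in> rel_ideal d}"
    unfolding rel_ideal_def
  proof (rule ring.genideal_minimal[OF free_ring])
    show "ideal {r \<in> carrier (free_algebra (gens d)).
        swap_poly r \<in> genideal (free_algebra (gens d)) (relators d)} (free_algebra (gens d))"
      by (fold rel_ideal_def) (rule ideal_vimage[OF rel_ideal])
    show "relators d \<subseteq> {r \<in> carrier (free_algebra (gens d)).
        swap_poly r \<in> genideal (free_algebra (gens d)) (relators d)}"
      using relators_closed relators_in_ideal swap_relators
      by (fold rel_ideal_def) blast
  qed
  then show "p \<in> rel_ideal d \<Longrightarrow> swap_poly p \<in> rel_ideal d" by blast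
qed

lemma star_proj: "star (proj d p) = proj d (swap_poly p)"
proof -
  have "swap_poly x \<in> proj d (swap_poly q)" if "x \<in> proj d q" for x q
    using swap_rel_ideal[of "x - q" d] that by (simp add: mem_proj)
  note mem = this
  show ?thesis
    unfolding star_def
  proof (intro equalityI subsetI)
    fix y assume "y \<in> proj d (swap_poly p)"
    from mem[OF this] have "swap_poly y \<in> proj d p" by simp
    then show "y \<in> swap_poly ` proj d p" by (intro image_eqI[of _ _ "swap_poly y"]) simp_all
  qed (auto intro: mem)
qed

lemma star_star: "x \<in> carrier (alg d) \<Longrightarrow> star (star x) = x"
  by (auto simp: carrier_alg star_proj)

theorem star_automorphism:
  fixes x :: "(gen, 'f::field) ncpoly set"
  shows "star \<in> ring_iso (alg d :: ('f, (gen, 'f) ncpoly set) module) (alg d)"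
    and "x \<in> carrier (alg d) \<Longrightarrow> star (c \<odot>\<^bsub>alg d\<^esub> x) = c \<odot>\<^bsub>alg d\<^esub> star x"
    and "star (gen_elt d (E i)) = gen_elt d (Es i)"
    and "star (gen_elt d (Es i)) = gen_elt d (E i)"
proof -
  have closed: "star x \<in> carrier (alg d)" if "x \<in> carrier (alg d)" for x :: "(gen, 'f) ncpoly set"
    using that by (auto simp: carrier_alg star_proj swap_poly_closed)
  show "star \<in> ring_iso (alg d :: ('f, (gen, 'f) ncpoly set) module) (alg d)"
  proof (rule ring_iso_memI)
    show "bij_betw star (carrier (alg d :: ('f, (gen, 'f) ncpoly set) module)) (carrier (alg d))"
      by (rule bij_betw_byWitness[where f' = star]) (auto simp: star_star closed)
  next
    fix x y :: "(gen, 'f) ncpoly set"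
    assume "x \<in> carrier (alg d)" "y \<in> carrier (alg d)"
    then obtain p q where "p \<in> carrier (free_algebra (gens d))" "x = proj d p"
      "q \<in> carrier (free_algebra (gens d))" "y = proj d q" by (auto simp: carrier_alg)
    then show "star (x \<otimes>\<^bsub>alg d\<^esub> y) = star x \<otimes>\<^bsub>alg d\<^esub> star y"
      "star (x \<oplus>\<^bsub>alg d\<^esub> y) = star x \<oplus>\<^bsub>alg d\<^esub> star y"
      by (simp_all add: star_proj swap_poly_closed flip: proj_simps(2,3))
  next
    show "star \<one>\<^bsub>alg d\<^esub> = (\<one>\<^bsub>alg d\<^esub> :: (gen, 'f) ncpoly set)"
      by (simp add: star_proj flip: proj_one)
  qed (rule closed)
  show "x \<in> carrier (alg d) \<Longrightarrow> star (c \<odot>\<^bsub>alg d\<^esub> x) = c \<odot>\<^bsub>alg d\<^esub> star x"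
    by (auto simp: carrier_alg alg_smult star_proj swap_poly_closed)
  show "star (gen_elt d (E i)) = gen_elt d (Es i)" "star (gen_elt d (Es i)) = gen_elt d (E i)"
    by (simp_all add: gen_elt_def star_proj)
qed

end

theory Submission
  imports Defs
begin

text \<open>
  Put \<open>t = tl r'\<close> and let \<open>W l j\<close> be the word with indices \<open>take l r @ j # drop l r @ t\<close>. For odd \<open>m\<close>
  and \<open>last r = hd r'\<close> the product is the word in which the last index of \<open>r\<close> is doubled. More
  generally let \<open>a l = W l (r ! l)\<close> be the word with the index \<open>r ! l\<close> doubled, so that also
  \<open>a (l - 1) = W l (r ! (l - 1))\<close>. Since the generators of one kind sum to \<open>1\<close>, summing
  \<open>W l j\<close> over all \<open>j\<close> deletes the inserted letter. This gives the word of \<open>r @ t\<close> if \<open>l = 0\<close>, and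
  \<open>0\<close> if \<open>0 < l < n\<close>, because then two orthogonal idempotents become adjacent. Hence the
  nonrepeating words in the \<open>l\<close>-th inner sum of (iv) add up to \<open>- a (l - 1) - a l\<close>, and the
  alternating sum over \<open>l\<close> telescopes to \<open>a (n - 1)\<close>. The computation is carried out
  with representatives in the free algebra, modulo the ideal of relations.
\<close>

section \<open>Letters, alternating words and their representatives\<close>

text \<open>Making the kind of a generator a Boolean turns the swap into negation and lets one
  argument serve both families of idempotents.\<close>

definition letter :: "bool \<Rightarrow> nat \<Rightarrow> gen" where
  "letter b i = (if b then E i else Es i)"

definition gen_prod :: "gen list \<Rightarrow> (gen, 'f::field) ncpoly" where
  "gen_prod gs = prod_list (map var gs)"

lemma gen_prod_simps [simp]:
  "gen_prod [] = 1" "gen_prod (g # gs) = var g * gen_prod gs"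
  "gen_prod (gs @ hs) = gen_prod gs * gen_prod hs"
  by (simp_all add: gen_prod_def)

lemma alt_gens_Cons: "alt_gens (r # rs) = letter (even (length rs)) r # alt_gens rs"
  by (simp add: letter_def)

lemma swap_letter [simp]: "swap_gen (letter b i) = letter (\<not> b) i"
  by (simp add: letter_def)

text \<open>The kind of a letter depends only on the parity of the number of letters after it, so a
  suffix of odd length swaps every letter in front of it.\<close>

lemma alt_gens_append:
  "alt_gens (xs @ ys) =
     (if even (length ys) then alt_gens xs else map swap_gen (alt_gens xs)) @ alt_gens ys"
  by (induction xs) (auto simp: alt_gens_Cons simp del: alt_gens.simps(2))

lemma letter_closed: "i \<le> d \<Longrightarrow> letter b i \<in> gens d"
  by (auto simp: letter_def gens_def)

lemma alt_gens_closed: "set rs \<subseteq> {0..d} \<Longrightarrow> set (alt_gens rs) \<subseteq> gens d"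
  by (induction rs) (auto simp: alt_gens_Cons letter_closed simp del: alt_gens.simps(2))

lemma gen_prod_closed: "set gs \<subseteq> gens d \<Longrightarrow> gen_prod gs \<in> carrier (free_algebra (gens d))"
  by (induction gs) (simp_all add: free_one free_mult var_closed)

lemma swap_gen_prod: "swap_poly (gen_prod gs) = gen_prod (map swap_gen gs)"
  by (induction gs) simp_all

lemma word_eq_proj:
  assumes "set rs \<subseteq> {0..d}"
  shows "word d rs = proj d (gen_prod (alt_gens rs))"
proof -
  have "foldr (mult (alg d)) (map (gen_elt d) gs) \<one>\<^bsub>alg d\<^esub> = proj d (gen_prod gs)"
    if "set gs \<subseteq> gens d" for gs
    using that by (induction gs)
      (simp_all add: proj_one gen_elt_def proj_simps(3) var_closed gen_prod_closed)
  then show ?thesis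
    using alt_gens_closed[OF assms] by (simp add: word_def)
qed

section \<open>Merging and deleting letters modulo the ideal of relations\<close>

lemma rel_ideal_zero: "0 \<in> rel_ideal d"
  using proj_eq_iff[of d 0 0] by simp

lemma rel_ideal_sum: "(\<And>i. i \<in> S \<Longrightarrow> f i \<in> rel_ideal d) \<Longrightarrow> sum f S \<in> rel_ideal d"
  by (induction S rule: infinite_finite_induct) (auto simp: rel_ideal_zero rel_ideal_closed(1))

lemma rel_ideal_sandwich:
  assumes "x \<in> rel_ideal d" "set us \<subseteq> gens d" "set vs \<subseteq> gens d"
  shows "gen_prod us * x * gen_prod vs \<in> rel_ideal d"
  by (intro rel_ideal_closed(3,4) assms gen_prod_closed)

lemma letter_mult_relation:
  assumes "i \<le> d" "j \<le> d"
  shows "var (letter b i) * var (letter b j) -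
    (if i = j then var (letter b i) else 0) \<in> (rel_ideal d :: (gen, 'f::field) ncpoly set)"
proof -
  have "var (letter b i) * var (letter b j) -
    (if i = j then var (letter b i) else 0) \<in> (relators d :: (gen, 'f) ncpoly set)"
    unfolding relators_def letter_def using assms by (cases b) auto
  then show ?thesis using relators_in_ideal by blast
qed

lemma letter_sum_relation:
  "1 - (\<Sum>i=0..d. var (letter b i)) \<in> (rel_ideal d :: (gen, 'f::field) ncpoly set)"
proof -
  have "1 - (\<Sum>i=0..d. var (letter b i)) \<in> (relators d :: (gen, 'f) ncpoly set)"
    unfolding relators_def letter_def by (cases b) simp_all
  then show ?thesis using relators_in_ideal by blast
qed

lemma gen_prod_merge:
  assumes "i \<le> d" "j \<le> d" "set us \<subseteq> gens d" "set vs \<subseteq> gens d"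
  shows "gen_prod (us @ letter b i # letter b j # vs) -
    (if i = j then gen_prod (us @ letter b i # vs) else 0) \<in> rel_ideal d"
  using rel_ideal_sandwich[OF letter_mult_relation[OF assms(1,2), of b] assms(3,4)]
  by (simp add: algebra_simps split: if_splits)

lemma gen_prod_insert_sum:
  assumes "set us \<subseteq> gens d" "set vs \<subseteq> gens d"
  shows "(\<Sum>j=0..d. gen_prod (us @ letter b j # vs)) - gen_prod (us @ vs) \<in> rel_ideal d"
  using rel_ideal_closed(2)[OF rel_ideal_sandwich[OF letter_sum_relation[where d=d and b=b] assms]]
  by (simp add: algebra_simps sum_distrib_left sum_distrib_right)

text \<open>Kinds are counted from the right, so a letter put in front changes no other
  letter.\<close>

lemma insert_sum_front:
  assumes "set rs \<subseteq> {0..d}"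
  shows "(\<Sum>j=0..d. gen_prod (alt_gens (j # rs))) - gen_prod (alt_gens rs) \<in> rel_ideal d"
  using gen_prod_insert_sum[of "[]" d "alt_gens rs" "even (length rs)"] alt_gens_closed[OF assms]
  by (simp add: alt_gens_Cons del: alt_gens.simps(2))

text \<open>With one letter between them, \<open>p\<close> and \<open>q\<close> have the same kind.
  Once the summation deletes that letter, they are adjacent orthogonal idempotents.\<close>

lemma insert_sum_between:
  assumes "set (xs @ p # q # ys) \<subseteq> {0..d}" "p \<noteq> q"
  shows "(\<Sum>j=0..d. gen_prod (alt_gens ((xs @ [p]) @ j # q # ys))) \<in> rel_ideal d"
proof -
  \<comment> \<open>After \<open>xs\<close> come \<open>p\<close>, \<open>j\<close>,
    \<open>q\<close> and \<open>ys\<close>, so the letters of \<open>xs\<close> are swapped iff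
    \<open>length ys + 3\<close> is odd.\<close>
  define us where "us = (if odd (length ys) then alt_gens xs else map swap_gen (alt_gens xs))"
  define b where "b = even (length ys)"
  have us: "set us \<subseteq> gens d"
    using alt_gens_closed[of xs d] assms(1) by (auto simp: us_def swap_gens)
  have ys: "set (alt_gens ys) \<subseteq> gens d" and pq: "p \<le> d" "q \<le> d"
    using alt_gens_closed[of ys d] assms(1) by auto
  have decomp: "alt_gens ((xs @ [p]) @ j # q # ys) =
      (us @ [letter b p]) @ letter (\<not> b) j # letter b q # alt_gens ys" for j
    by (simp add: alt_gens_append alt_gens_Cons us_def b_def del: alt_gens.simps(2))
  have "(\<Sum>j=0..d. gen_prod (alt_gens ((xs @ [p]) @ j # q # ys))) -
      gen_prod (us @ letter b p # letter b q # alt_gens ys) \<in> rel_ideal d"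
    using gen_prod_insert_sum[of "us @ [letter b p]" d "letter b q # alt_gens ys" "\<not> b"]
      us ys pq unfolding decomp by (simp add: letter_closed)
  moreover have "gen_prod (us @ letter b p # letter b q # alt_gens ys) \<in> rel_ideal d"
    using gen_prod_merge[OF pq us ys, of b] assms(2) by simp
  ultimately show ?thesis
    using rel_ideal_closed(1) by fastforce
qed

section \<open>Alternating sums, and the passage of sums and signs to the quotient\<close>

text \<open>Each \<open>a l\<close> with \<open>0 < l < k\<close> occurs in two consecutive
  summands, with opposite signs; only the two ends survive.\<close>

lemma alternating_telescope:
  fixes a :: "nat \<Rightarrow> 'a::ring_1"
  shows "(\<Sum>l=1..k. (- 1) ^ (Suc k - l) * (a (l - 1) + a l)) = (- 1) ^ k * a 0 - a k"
proof (induction k)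
  case (Suc k)
  \<comment> \<open>Raising \<open>k\<close> by one raises every old exponent by one, hence negates
    the old sum.\<close>
  have "(\<Sum>l=1..k. (- 1) ^ (Suc (Suc k) - l) * (a (l - 1) + a l)) =
      - (\<Sum>l=1..k. (- 1) ^ (Suc k - l) * (a (l - 1) + a l))"
    unfolding sum_negf[symmetric] by (intro sum.cong) (auto simp: Suc_diff_le)
  then show ?case using Suc by simp
qed simp

lemma finsum_proj:
  assumes "finite S" "\<And>i. i \<in> S \<Longrightarrow> f i \<in> carrier (free_algebra (gens d))"
  shows "(\<Oplus>\<^bsub>alg d\<^esub>i\<in>S. proj d (f i)) = proj d (\<Sum>i\<in>S. f i :: (gen, 'f::field) ncpoly)"
  using assms
proof (induction S rule: finite_induct)
  case empty
  interpret A: ring "alg d :: ('f, (gen, 'f) ncpoly set) module" by (rule alg_ring)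
  show ?case by (simp add: proj_zero)
next
  case (insert x S)
  interpret A: ring "alg d :: ('f, (gen, 'f) ncpoly set) module" by (rule alg_ring)
  have "(\<lambda>i. proj d (f i)) \<in> S \<rightarrow> carrier (alg d)" "proj d (f x) \<in> carrier (alg d)"
    using insert.prems by (auto intro: proj_simps(1))
  then show ?case
    using insert by (simp add: proj_simps free_sum)
qed

text \<open>Turns scalar signs into powers of \<open>- 1\<close> in the free algebra, where ordinary
  ring arithmetic applies.\<close>

lemma single_minus_one_power:
  "Poly_Mapping.single 0 ((- 1) ^ k) = ((- 1) ^ k :: ('g, 'f::field) ncpoly)"
proof (induction k)
  case (Suc k)
  have "Poly_Mapping.single 0 ((- 1) ^ Suc k) =
      Poly_Mapping.single 0 (- 1) * (Poly_Mapping.single 0 ((- 1) ^ k) :: ('g, 'f) ncpoly)"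
    by (simp add: mult_single)
  also have "Poly_Mapping.single 0 (- 1) = (- 1 :: ('g, 'f) ncpoly)"
    by (simp add: single_uminus)
  finally show ?case using Suc by simp
qed simp

lemma sign_closed: "(- 1) ^ k \<in> carrier (free_algebra G)"
  using free_const[of "(- 1) ^ k" G] by (simp add: single_minus_one_power)

lemma alg_smult_sign:
  "p \<in> carrier (free_algebra (gens d)) \<Longrightarrow>
    (- 1) ^ k \<odot>\<^bsub>alg d\<^esub> proj d p = proj d ((- 1) ^ k * p)"
  by (simp add: alg_smult single_minus_one_power)

section \<open>Products of a starred word and a nonstarred one\<close>

lemma star_word_mult_word:
  assumes "set r \<subseteq> {0..d}" "set r' \<subseteq> {0..d}"
  shows "star (word d r) \<otimes>\<^bsub>alg d\<^esub> word d r' =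
    proj d (gen_prod (map swap_gen (alt_gens r) @ alt_gens r'))"
proof -
  have "set (map swap_gen (alt_gens r)) \<subseteq> gens d"
    using alt_gens_closed[OF assms(1)] by (auto simp: swap_gens)
  then show ?thesis
    using alt_gens_closed[OF assms(2)]
    by (simp add: word_eq_proj assms star_proj swap_gen_prod proj_simps(3) gen_prod_closed)
qed

text \<open>The swap made by \<open>star\<close> is exactly the one that a suffix of odd length
  forces on \<open>r\<close>, so the letters already alternate across the junction.\<close>

lemma star_word_mult_word_odd:
  assumes "set r \<subseteq> {0..d}" "set r' \<subseteq> {0..d}" "odd (length r')"
  shows "star (word d r) \<otimes>\<^bsub>alg d\<^esub> word d r' =
    (word d (r @ r') :: (gen, 'f::field) ncpoly set)"
proof -
  have "set (r @ r') \<subseteq> {0..d}" using assms by simp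
  then show ?thesis
    unfolding star_word_mult_word[OF assms(1,2)]
    using assms(3) by (simp add: word_eq_proj alt_gens_append del: set_append)
qed

text \<open>Here \<open>q # t\<close> has even length and begins with a starred letter, so two
  starred idempotents meet at the junction.\<close>

lemma star_word_mult_word_even:
  assumes "set (xs @ [p]) \<subseteq> {0..d}" "set (q # t) \<subseteq> {0..d}" "odd (length t)"
  shows "star (word d (xs @ [p])) \<otimes>\<^bsub>alg d\<^esub> word d (q # t) =
    (if p = q then word d (xs @ p # t) else (\<zero>\<^bsub>alg d\<^esub> :: (gen, 'f::field) ncpoly set))"
proof -
  define P :: "(gen, 'f) ncpoly" where "P = gen_prod (map swap_gen (alt_gens (xs @ [p])) @ alt_gens (q # t))"
  have xs: "set (alt_gens xs) \<subseteq> gens d" and t: "set (alt_gens t) \<subseteq> gens d"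
    and pq: "p \<le> d" "q \<le> d"
    using alt_gens_closed[of xs d] alt_gens_closed[of t d] assms by auto
  \<comment> \<open>On \<open>xs\<close> the swap made by \<open>star\<close> cancels the one caused
    by the single letter \<open>p\<close> after it.\<close>
  have P: "P = gen_prod (alt_gens xs @ letter False p # letter False q # alt_gens t)"
    using assms(3) unfolding P_def
    by (simp add: alt_gens_append alt_gens_Cons comp_def del: alt_gens.simps(2))
  have m: "P - (if p = q then gen_prod (alt_gens xs @ letter False p # alt_gens t) else 0)
      \<in> rel_ideal d"
    unfolding P by (rule gen_prod_merge[OF pq xs t])
  have "set (xs @ p # t) \<subseteq> {0..d}" using assms by simp
  then have "word d (xs @ p # t) =
      proj d (gen_prod (alt_gens xs @ letter False p # alt_gens t) :: (gen, 'f) ncpoly)"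
    using assms(3) by (simp add: word_eq_proj alt_gens_append alt_gens_Cons del: alt_gens.simps(2))
  moreover have "star (word d (xs @ [p])) \<otimes>\<^bsub>alg d\<^esub> word d (q # t) = proj d P"
    unfolding P_def by (rule star_word_mult_word[OF assms(1,2)])
  moreover have "proj d P =
      proj d (if p = q then gen_prod (alt_gens xs @ letter False p # alt_gens t) else 0)"
    unfolding proj_eq_iff by (rule m)
  ultimately show ?thesis by (cases "p = q") (simp_all add: proj_zero)
qed

section \<open>Expansion of a word with doubled last index\<close>

text \<open>This is case (iv) once the product has been identified with the concatenated word, in
  which \<open>last r\<close> is followed by an equal index.\<close>

lemma doubled_last_expansion:
  fixes d n :: nat and r t :: "nat list"
  assumes n: "length r = n" "n \<ge> 1" and r: "set r \<subseteq> {0..d}" "distinct_adj r"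
    and t: "set t \<subseteq> {0..d}"
  shows "word d (r @ last r # t) =
        (- 1) ^ (n + 1) \<odot>\<^bsub>alg d\<^esub> (word d (r @ t) :: (gen, 'f::field) ncpoly set)
          \<oplus>\<^bsub>alg d\<^esub> (- 1) ^ n \<odot>\<^bsub>alg d\<^esub>
              (\<Oplus>\<^bsub>alg d\<^esub>j\<in>{j. j \<le> d \<and> j \<noteq> hd r}. word d (j # r @ t))
          \<oplus>\<^bsub>alg d\<^esub>
              (\<Oplus>\<^bsub>alg d\<^esub>l\<in>{1..n-1}. (- 1) ^ (n - l) \<odot>\<^bsub>alg d\<^esub>
                 (\<Oplus>\<^bsub>alg d\<^esub>j\<in>{j. j \<le> d \<and> j \<noteq> r ! (l - 1) \<and> j \<noteq> r ! l}.
                    word d (take l r @ j # drop l r @ t)))"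
proof -
  let ?F = "carrier (free_algebra (gens d)) :: (gen, 'f) ncpoly set"
  define W :: "nat \<Rightarrow> nat \<Rightarrow> (gen, 'f) ncpoly"
    where "W l j = gen_prod (alt_gens (take l r @ j # drop l r @ t))" for l j
  define a where "a l = W l (r ! l)" for l
  define D where "D l = (\<Sum>j=0..d. W l j)" for l
  define w :: "(gen, 'f) ncpoly" where "w = gen_prod (alt_gens (r @ t))"
  define S where "S l = {j. j \<le> d \<and> j \<noteq> r ! (l - 1) \<and> j \<noteq> r ! l}" for l
  define S0 where "S0 = {j. j \<le> d \<and> j \<noteq> hd r}"
  have fin: "finite (S l)" "finite S0" for l
    unfolding S_def S0_def by (auto intro: finite_subset[of _ "{..d}"])
  have in_range: "set (take l r @ j # drop l r @ t) \<subseteq> {0..d}" if "j \<le> d" for l j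
    using r(1) t that set_take_subset[of l r] set_drop_subset[of l r] by auto
  have nth_le: "r ! l \<le> d" if "l < n" for l
    using r(1) n(1) that by (metis atLeastAtMost_iff nth_mem subsetD)
  have W_closed: "W l j \<in> ?F" if "j \<le> d" for l j
    unfolding W_def by (intro gen_prod_closed alt_gens_closed in_range that)
  have W_word: "word d (take l r @ j # drop l r @ t) = proj d (W l j)" if "j \<le> d" for l j
    unfolding W_def by (rule word_eq_proj[OF in_range[OF that]])
  have rt: "set (r @ t) \<subseteq> {0..d}" using r(1) t by simp
  have w_closed: "w \<in> ?F"
    unfolding w_def by (rule gen_prod_closed[OF alt_gens_closed[OF rt]])
  have w_word: "word d (r @ t) = proj d w"
    unfolding w_def by (rule word_eq_proj[OF rt])
  have hd: "hd r = r ! 0" using n by (cases r) auto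

  \<comment> \<open>Doubling \<open>r ! (l - 1)\<close> by a copy after it or by a copy before it
    gives the same list.\<close>
  have a_prev: "W l (r ! (l - 1)) = a (l - 1)" if "l \<in> {1..n-1}" for l
  proof -
    obtain k where l: "l = Suc k" "k < length r" using \<open>l \<in> {1..n-1}\<close> n by (cases l) auto
    then show ?thesis
      by (simp add: a_def W_def take_Suc_conv_app_nth flip: Cons_nth_drop_Suc)
  qed
  have distinct: "r ! (l - 1) \<noteq> r ! l" if "l \<in> {1..n-1}" for l
    using r(2) that n distinct_adj_conv_nth[of r] by (cases l) auto
  \<comment> \<open>The two excluded indices are distinct because \<open>r\<close> is nonrepeating,
    so exactly two terms leave the full sum; at the front only one does.\<close>
  have sum_S: "(\<Sum>j\<in>S l. W l j) = D l - (a (l - 1) + a l)" if l: "l \<in> {1..n-1}" for l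
  proof -
    have "{0..d} = insert (r ! (l - 1)) (insert (r ! l) (S l))"
      using nth_le[of l] nth_le[of "l - 1"] l unfolding S_def by auto
    moreover have "r ! (l - 1) \<notin> insert (r ! l) (S l)" "r ! l \<notin> S l"
      using distinct[OF l] unfolding S_def by auto
    ultimately have "D l = W l (r ! (l - 1)) + (W l (r ! l) + (\<Sum>j\<in>S l. W l j))"
      unfolding D_def by (simp add: fin)
    then show ?thesis
      unfolding a_prev[OF l] by (simp add: a_def algebra_simps)
  qed
  have sum_S0: "(\<Sum>j\<in>S0. W 0 j) = D 0 - a 0"
  proof -
    have "{0..d} = insert (r ! 0) S0" "r ! 0 \<notin> S0"
      using nth_le[of 0] n unfolding S0_def hd by auto
    then have "D 0 = W 0 (r ! 0) + (\<Sum>j\<in>S0. W 0 j)"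
      unfolding D_def by (simp add: fin)
    then show ?thesis by (simp add: a_def)
  qed

  have D0: "D 0 - w \<in> rel_ideal d"
    using insert_sum_front[OF rt] by (simp add: D_def W_def w_def)
  have Dl: "D l \<in> rel_ideal d" if l: "l \<in> {1..n-1}" for l
  proof -
    obtain k where k: "l = Suc k" "k < length r" "Suc k < length r"
      using l n by (cases l) auto
    have *: "take l r = take k r @ [r ! k]" "drop l r = r ! l # drop (Suc l) r"
      using k by (simp_all add: take_Suc_conv_app_nth Cons_nth_drop_Suc)
    have "set (take k r @ r ! k # r ! l # drop (Suc l) r @ t) \<subseteq> {0..d}"
      using r(1) t nth_le[of k] nth_le[of l] k n set_take_subset[of k r]
        set_drop_subset[of "Suc l" r] by auto
    from insert_sum_between[OF this] show ?thesis
      using distinct[OF l] unfolding D_def W_def * by (simp add: k)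
  qed

  \<comment> \<open>A representative of the right-hand side; it will differ from
    \<open>a (n - 1)\<close> only by multiples of \<open>D 0 - w\<close> and of the
    \<open>D l\<close>.\<close>
  define R where "R = (- 1) ^ (n + 1) * w + (- 1) ^ n * (\<Sum>j\<in>S0. W 0 j) +
      (\<Sum>l=1..n-1. (- 1) ^ (n - l) * (\<Sum>j\<in>S l. W l j))"
  \<comment> \<open>Writing \<open>n\<close> as \<open>Suc (n - 1)\<close> in the exponent fits the
    telescoping sum with \<open>k = n - 1\<close>.\<close>
  have "(\<Sum>l=1..n-1. (- 1) ^ (n - l) * (\<Sum>j\<in>S l. W l j)) =
      (\<Sum>l=1..n-1. (- 1) ^ (n - l) * D l) -
      (\<Sum>l=1..n-1. (- 1) ^ (Suc (n - 1) - l) * (a (l - 1) + a l))"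
    unfolding sum_subtractf[symmetric]
    using n(2) by (intro sum.cong) (simp_all add: sum_S right_diff_distrib)
  also have "\<dots> = (\<Sum>l=1..n-1. (- 1) ^ (n - l) * D l) - ((- 1) ^ (n - 1) * a 0 - a (n - 1))"
    unfolding alternating_telescope ..
  \<comment> \<open>With this sign the left end of the telescope cancels the \<open>a 0\<close>
    removed from the front sum.\<close>
  also have "(- 1) ^ (n - 1) * a 0 = - ((- 1) ^ n * a 0)"
    using n(2) by (cases n) simp_all
  finally have "R - a (n - 1) =
      (- 1) ^ n * (D 0 - w) + (\<Sum>l=1..n-1. (- 1) ^ (n - l) * D l)"
    unfolding R_def sum_S0 by (simp add: algebra_simps)
  also have "\<dots> \<in> rel_ideal d"
    by (intro rel_ideal_closed(1,4) rel_ideal_sum D0 Dl sign_closed)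
  finally have R: "proj d (a (n - 1)) = proj d R"
    using proj_eq_iff by metis

  have sum_closed: "(\<Sum>j\<in>S l. W l j) \<in> ?F" "(\<Sum>j\<in>S0. W 0 j) \<in> ?F" for l
    by (auto intro!: free_sum W_closed simp: S_def S0_def)
  have inner: "(\<Oplus>\<^bsub>alg d\<^esub>j\<in>S l. word d (take l r @ j # drop l r @ t)) = proj d (\<Sum>j\<in>S l. W l j)"
    for l
  proof -
    interpret A: ring "alg d :: ('f, (gen, 'f) ncpoly set) module" by (rule alg_ring)
    have "(\<Oplus>\<^bsub>alg d\<^esub>j\<in>S l. word d (take l r @ j # drop l r @ t)) =
        (\<Oplus>\<^bsub>alg d\<^esub>j\<in>S l. proj d (W l j))"
      by (rule A.finsum_cong') (auto simp: S_def W_word intro!: proj_simps(1) W_closed)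
    also have "\<dots> = proj d (\<Sum>j\<in>S l. W l j)"
      by (intro finsum_proj fin W_closed) (auto simp: S_def)
    finally show ?thesis .
  qed
  have front: "(\<Oplus>\<^bsub>alg d\<^esub>j\<in>S0. word d (j # r @ t)) = proj d (\<Sum>j\<in>S0. W 0 j)"
  proof -
    interpret A: ring "alg d :: ('f, (gen, 'f) ncpoly set) module" by (rule alg_ring)
    have "(\<Oplus>\<^bsub>alg d\<^esub>j\<in>S0. word d (j # r @ t)) = (\<Oplus>\<^bsub>alg d\<^esub>j\<in>S0. proj d (W 0 j))"
      using W_word[of _ 0]
      by (intro A.finsum_cong') (auto simp: S0_def intro!: proj_simps(1) W_closed)
    also have "\<dots> = proj d (\<Sum>j\<in>S0. W 0 j)"
      by (intro finsum_proj fin W_closed) (auto simp: S0_def)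
    finally show ?thesis .
  qed
  have outer: "(\<Oplus>\<^bsub>alg d\<^esub>l\<in>{1..n-1}. (- 1) ^ (n - l) \<odot>\<^bsub>alg d\<^esub> proj d (\<Sum>j\<in>S l. W l j)) =
      proj d (\<Sum>l=1..n-1. (- 1) ^ (n - l) * (\<Sum>j\<in>S l. W l j))"
    unfolding alg_smult_sign[OF sum_closed(1)]
    by (intro finsum_proj free_mult sign_closed sum_closed) simp
  have last: "last r = r ! (n - 1)" using n by (subst last_conv_nth) auto
  \<comment> \<open>Inserting the last index just before itself gives the doubled word, so
    \<open>a (n - 1)\<close> represents the left-hand side.\<close>
  have "r = take (n - 1) r @ [r ! (n - 1)]" "drop (n - 1) r = [r ! (n - 1)]"
    using n take_Suc_conv_app_nth[of "n - 1" r] Cons_nth_drop_Suc[of "n - 1" r] by simp_all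
  then have "take (n - 1) r @ r ! (n - 1) # drop (n - 1) r @ t = r @ last r # t"
    unfolding last by (metis append.assoc append_Cons append_Nil)
  then have "W (n - 1) (r ! (n - 1)) = gen_prod (alt_gens (r @ last r # t))"
    unfolding W_def by (rule arg_cong)
  moreover have "set (r @ last r # t) \<subseteq> {0..d}"
    using r(1) t n(2) nth_le[of "n - 1"] unfolding last by auto
  ultimately have "word d (r @ last r # t) = proj d (a (n - 1))"
    unfolding a_def by (simp add: word_eq_proj)
  also note R
  also have "proj d R = (- 1) ^ (n + 1) \<odot>\<^bsub>alg d\<^esub> proj d w
      \<oplus>\<^bsub>alg d\<^esub> (- 1) ^ n \<odot>\<^bsub>alg d\<^esub> proj d (\<Sum>j\<in>S0. W 0 j)
      \<oplus>\<^bsub>alg d\<^esub> proj d (\<Sum>l=1..n-1. (- 1) ^ (n - l) * (\<Sum>j\<in>S l. W l j))"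
    unfolding R_def alg_smult_sign[OF w_closed] alg_smult_sign[OF sum_closed(2)]
    by (simp only: proj_simps(2) free_add free_mult free_sum sign_closed sum_closed w_closed)
  finally show ?thesis
    unfolding S_def[symmetric] S0_def[symmetric] w_word front inner outer .
qed

section \<open>The four cases and the nonrepeating property of the resulting words\<close>

theorem theorem4p2:
  fixes d n m :: nat and r r' :: "nat list" and Q :: "(gen, 'f::field) ncpoly set"
  assumes "d \<ge> 1"
    and "length r = n" and "length r' = m" and "n \<ge> 1" and "m \<ge> 1"
    and "NR d r" and "NR d r'"
    and Q: "Q = star (word d r) \<otimes>\<^bsub>alg d\<^esub> word d r'"
  shows
    "(even m \<and> last r \<noteq> hd r' \<longrightarrow> Q = \<zero>\<^bsub>alg d\<^esub>) \<and>
     (even m \<and> last r = hd r' \<longrightarrow>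
        NR d (r @ tl r') \<and> Q = word d (r @ tl r')) \<and>
     (odd m \<and> last r \<noteq> hd r' \<longrightarrow>
        NR d (r @ r') \<and> Q = word d (r @ r')) \<and>
     (odd m \<and> last r = hd r' \<longrightarrow>
        NR d (r @ tl r') \<and>
        (\<forall>j\<in>{0..d}. j \<noteq> hd r \<longrightarrow> NR d (j # r @ tl r')) \<and>
        (\<forall>l\<in>{1..n-1}. \<forall>j\<in>{0..d}. j \<noteq> r ! (l - 1) \<and> j \<noteq> r ! l \<longrightarrow>
           NR d (take l r @ j # drop l r @ tl r')) \<and>
        Q = (- 1) ^ (n + 1) \<odot>\<^bsub>alg d\<^esub> word d (r @ tl r')
          \<oplus>\<^bsub>alg d\<^esub> (- 1) ^ n \<odot>\<^bsub>alg d\<^esub>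
              (\<Oplus>\<^bsub>alg d\<^esub>j\<in>{j. j \<le> d \<and> j \<noteq> hd r}. word d (j # r @ tl r'))
          \<oplus>\<^bsub>alg d\<^esub>
              (\<Oplus>\<^bsub>alg d\<^esub>l\<in>{1..n-1}. (- 1) ^ (n - l) \<odot>\<^bsub>alg d\<^esub>
                 (\<Oplus>\<^bsub>alg d\<^esub>j\<in>{j. j \<le> d \<and> j \<noteq> r ! (l - 1) \<and> j \<noteq> r ! l}.
                    word d (take l r @ j # drop l r @ tl r'))))"
proof -
  obtain xs p where r: "r = xs @ [p]"
    using \<open>NR d r\<close> unfolding NR_def by (metis rev_exhaust)
  obtain q t where r': "r' = q # t"
    using \<open>NR d r'\<close> unfolding NR_def by (metis list.exhaust)
  have rng: "set r \<subseteq> {0..d}" "set r' \<subseteq> {0..d}"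
    and adj: "distinct_adj r" "distinct_adj r'"
    using assms unfolding NR_def by auto
  have m: "odd (length t) \<longleftrightarrow> even m"
    using \<open>length r' = m\<close> r' by auto
  have Q_even: "Q = (if p = q then word d (xs @ p # t) else \<zero>\<^bsub>alg d\<^esub>)" if "even m"
    unfolding Q r r' using rng that m unfolding r r'
    by (intro star_word_mult_word_even) auto
  have Q_odd: "Q = word d (r @ r')" if "odd m"
    unfolding Q using rng that \<open>length r' = m\<close> by (intro star_word_mult_word_odd) auto
  have NR_app: "NR d (r @ r')" if "p \<noteq> q"
    using rng adj that unfolding NR_def r r' by (auto simp: distinct_adj_append_iff)
  \<comment> \<open>If \<open>t\<close> is nonempty, its head differs from \<open>q = p\<close>
    because \<open>r'\<close> is nonrepeating.\<close>
  have NR_tl: "NR d (r @ t)" if "p = q"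
    using rng adj that unfolding NR_def r r'
    by (cases t) (auto simp: distinct_adj_append_iff)
  have NR_front: "NR d (j # r @ t)" if "p = q" "j \<le> d" "j \<noteq> hd r" for j
    using NR_tl[OF that(1)] that(2,3) r
    unfolding NR_def by (auto simp: distinct_adj_Cons hd_append)
  have NR_ins: "NR d (take l r @ j # drop l r @ t)"
    if "p = q" "l \<in> {1..n-1}" "j \<le> d" "j \<noteq> r ! (l - 1)" "j \<noteq> r ! l" for l j
  proof -
    \<comment> \<open>Both parts of the split are nonempty, so the neighbours of \<open>j\<close>
      are \<open>r ! (l - 1)\<close> and \<open>r ! l\<close>.\<close>
    have l: "l < length r" "l \<ge> 1" using that(2) \<open>length r = n\<close> by auto
    have "NR d (take l r @ drop l r @ t)"
      using NR_tl[OF that(1)] by (simp flip: append_assoc)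
    moreover have "last (take l r) = r ! (l - 1)"
      using l by (subst last_conv_nth) (auto simp: nth_take)
    moreover have "hd (drop l r @ t) = r ! l"
      using l by (simp add: hd_drop_conv_nth hd_append)
    moreover have "take l r \<noteq> []" "drop l r \<noteq> []" using l by auto
    ultimately show ?thesis
      using that(3-5) unfolding NR_def distinct_adj_append_iff distinct_adj_Cons by auto
  qed
  have "hd r' = q" "tl r' = t" "last r = p" using r r' by simp_all
  \<comment> \<open>Rewrites the concatenation from \<open>Q_odd\<close> as the doubled word, to
    which the expansion applies.\<close>
  moreover have "r @ r' = r @ last r # t" if "p = q" using that r r' by simp
  moreover have "set t \<subseteq> {0..d}" using rng r' by auto
  note doubled_last_expansion[OF \<open>length r = n\<close> \<open>n \<ge> 1\<close> rng(1) adj(1) this]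
  ultimately show ?thesis
    using Q_even Q_odd NR_app NR_tl NR_front NR_ins r by auto
qed

end
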